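(* Let $F(x,\dot x)$ be a smooth function of positions and velocities on a 4-dimensional spacetime with coordinates $x^a=(ct,x^\alpha)$, positively $1$-homogeneous in the velocities, $F(x,\sigma\dot x)=\sigma F(x,\dot x)$ for all $\sigma>0$, and let $L=F^2$. Set $$f(ct,x^\alpha,\epsilon^\alpha)=F(ct,x^\alpha,1,\epsilon^\alpha),\qquad \epsilon^\alpha=\frac{\dot x^\alpha}{c\,\dot t}=\frac{v^\alpha}{c},$$ so that $L=c^2\dot t^2f^2$ for $\dot t>0$. Assume that $f\neq0$ and that the matrix $f_{\alpha\beta}=\partial^2f/\partial\epsilon^\alpha\partial\epsilon^\beta$ is invertible, with inverse $f^{\alpha\beta}$. Then for every solution of the Finsler geodesic equation $$\ddot x^a+2G^a(x,\dot x)=0$$ with $\dot t>0$, reparametrized by the coordinate time $t$, the spatial acceleration is $$\frac{d^2x^\alpha}{dt^2}=f^{\alpha\beta}\left(c^2\,\partial_\beta f-c\,(\partial_tf_\beta+v^\gamma\partial_\gamma f_\beta)\right),$$ and the same equations of motion are the Euler–Lagrange equations of $f$ regarded as a Lagrangian in $(t,x^\alpha,v^\alpha)$, $$\frac{d}{dt}\frac{\partial f}{\partial v^\alpha}-\frac{\partial f}{\partial x^\alpha}=0 .$$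
   Context: Indices $a,b,c,\dots$ run over $0,\dots,3$ and $\alpha,\beta,\dots$ over $1,2,3$; the constant $c>0$ is the speed of light. A dot denotes the derivative with respect to the curve parameter $\tau$; $\partial_a=\partial/\partial x^a$, $\dot\partial_a=\partial/\partial\dot x^a$. The Finsler metric is $g^L_{ab}=\tfrac12\dot\partial_a\dot\partial_bL$, with inverse $g^{L\,ab}$, and the geodesic spray coefficients are $$G^a(x,\dot x)=\tfrac14g^{L\,ab}\left(\dot x^c\partial_c\dot\partial_bL-\partial_bL\right).$$ In the conclusion, $v^\alpha=dx^\alpha/dt$, $f$ and its derivatives are evaluated at $(ct,x^\alpha,\epsilon^\alpha=v^\alpha/c)$, $f_\beta=\partial f/\partial\epsilon^\beta$, and $\partial_t=\partial/\partial t$ and $\partial_\gamma=\partial/\partial x^\gamma$ are taken at fixed $\epsilon$. *)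

theory Defs
  imports "HOL-Analysis.Analysis"
begin

fun C_k_on :: "nat \<Rightarrow> ('a::real_normed_vector \<Rightarrow> real) \<Rightarrow> 'a set \<Rightarrow> bool" where
  "C_k_on 0 h S \<longleftrightarrow> continuous_on S h"
| "C_k_on (Suc k) h S \<longleftrightarrow>
     (\<forall>p\<in>S. h differentiable (at p)) \<and>
     (\<forall>v. C_k_on k (\<lambda>p. frechet_derivative h (at p) v) S)"

definition smooth_on :: "('a::real_normed_vector \<Rightarrow> real) \<Rightarrow> 'a set \<Rightarrow> bool" where
  "smooth_on h S \<longleftrightarrow> (\<forall>k. C_k_on k h S)"

text \<open>Derivative along \<open>v\<close>; with a basis vector for \<open>v\<close>, the partial derivative in that coordinate.\<close>

definition dir_deriv :: "'a::real_normed_vector \<Rightarrow> ('a \<Rightarrow> real) \<Rightarrow> 'a \<Rightarrow> real" where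
  "dir_deriv v h p = deriv (\<lambda>s. h (p + s *\<^sub>R v)) 0"

text \<open>
  The numeral type \<open>4\<close> is the type of integers mod 4. The index \<open>0 :: 4\<close> is time and
  \<open>1, 2, 3 :: 4\<close> are space. In the type \<open>3\<close> of spatial indices, \<open>3 = 0\<close>.
\<close>

definition space_idx :: "3 \<Rightarrow> 4" where
  "space_idx \<alpha> = (if \<alpha> = 1 then 1 else if \<alpha> = 2 then 2 else 3)"

definition spatial :: "real^4 \<Rightarrow> real^3" where
  "spatial y = (\<chi> \<alpha>. y $ space_idx \<alpha>)"

text \<open>The vector \<open>(w, x\<^sup>1, x\<^sup>2, x\<^sup>3)\<close>, used for positions and for velocities.\<close>

definition four :: "real \<Rightarrow> real^3 \<Rightarrow> real^4" where
  "four w x = axis 0 w + (\<Sum>\<alpha>\<in>UNIV. axis (space_idx \<alpha>) (x $ \<alpha>))"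

lemma space_idx_simps [simp]: "space_idx 1 = 1" "space_idx 2 = 2" "space_idx 3 = 3"
  by (simp_all add: space_idx_def)

lemma four_eq_0: "(4::4) = 0"
  by simp

lemma four_nth: "four w x $ 0 = w" "four w x $ 1 = x $ 1" "four w x $ 2 = x $ 2"
    "four w x $ 3 = x $ 3" "four w x $ 4 = w"
  by (simp_all add: four_def axis_def sum_3)

lemma spatial_four [simp]: "spatial (four w x) = x"
  by (simp add: spatial_def vec_eq_iff forall_3 four_nth)

lemma four_spatial [simp]: "four (y $ 0) (spatial y) = y"
proof -
  have "four (y $ 0) (spatial y) $ i = y $ i" for i :: 4
    using exhaust_4[of i] by (auto simp: four_nth spatial_def simp flip: four_eq_0)
  then show ?thesis by (simp add: vec_eq_iff)
qed

lemma scaleR_four: "r *\<^sub>R four w x = four (r * w) (r *\<^sub>R x)"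
proof -
  have "(r *\<^sub>R four w x) $ i = four (r * w) (r *\<^sub>R x) $ i" for i :: 4
    using exhaust_4[of i] by (auto simp: four_nth)
  then show ?thesis by (simp add: vec_eq_iff)
qed

type_synonym tangent_point = "(real^4) \<times> (real^4)"
type_synonym reduced_point = "real \<times> (real^3) \<times> (real^3)"

text \<open>
  The domain \<open>D\<close> consists of pairs (position, velocity). It is conic in the velocities and need not
  contain all velocities: a \<open>1\<close>-homogeneous function that is differentiable at velocity zero is
  linear in the velocities.
\<close>

definition pos_homogeneous_on :: "tangent_point set \<Rightarrow> (tangent_point \<Rightarrow> real) \<Rightarrow> bool" where
  "pos_homogeneous_on D F \<longleftrightarrow>
     (\<forall>x y \<sigma>. (x, y) \<in> D \<longrightarrow> \<sigma> > 0 \<longrightarrow>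
        (x, \<sigma> *\<^sub>R y) \<in> D \<and> F (x, \<sigma> *\<^sub>R y) = \<sigma> * F (x, y))"

abbreviation d_pos :: "4 \<Rightarrow> (tangent_point \<Rightarrow> real) \<Rightarrow> tangent_point \<Rightarrow> real" where
  "d_pos a \<equiv> dir_deriv (axis a 1, 0)"

abbreviation d_vel :: "4 \<Rightarrow> (tangent_point \<Rightarrow> real) \<Rightarrow> tangent_point \<Rightarrow> real" where
  "d_vel a \<equiv> dir_deriv (0, axis a 1)"

definition finsler_L :: "(tangent_point \<Rightarrow> real) \<Rightarrow> tangent_point \<Rightarrow> real" where
  "finsler_L F p = (F p)\<^sup>2"

definition finsler_metric :: "(tangent_point \<Rightarrow> real) \<Rightarrow> tangent_point \<Rightarrow> real^4^4" where
  "finsler_metric L p = (\<chi> a b. 1/2 * d_vel a (d_vel b L) p)"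

definition spray :: "(tangent_point \<Rightarrow> real) \<Rightarrow> tangent_point \<Rightarrow> real^4" where
  "spray L p = (\<chi> a. 1/4 * (\<Sum>b\<in>UNIV. matrix_inv (finsler_metric L p) $ a $ b *
       ((\<Sum>c\<in>UNIV. snd p $ c * d_pos c (d_vel b L) p) - d_pos b L p)))"

definition velocity :: "(real \<Rightarrow> 'a::real_normed_vector) \<Rightarrow> real \<Rightarrow> 'a" where
  "velocity X \<tau> = vector_derivative X (at \<tau>)"

definition twice_differentiable_on :: "(real \<Rightarrow> 'a::real_normed_vector) \<Rightarrow> real set \<Rightarrow> bool" where
  "twice_differentiable_on X I \<longleftrightarrow>
     (\<forall>\<tau>\<in>I. X differentiable (at \<tau>) \<and> velocity X differentiable (at \<tau>))"

definition finsler_geodesic ::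
  "tangent_point set \<Rightarrow> (tangent_point \<Rightarrow> real) \<Rightarrow> real set \<Rightarrow> (real \<Rightarrow> real^4) \<Rightarrow> bool" where
  "finsler_geodesic D L I X \<longleftrightarrow>
     open I \<and> is_interval I \<and> twice_differentiable_on X I \<and>
     (\<forall>\<tau>\<in>I. (X \<tau>, velocity X \<tau>) \<in> D \<and>
        velocity (velocity X) \<tau> + 2 *\<^sub>R spray L (X \<tau>, velocity X \<tau>) = 0)"

definition coord_time :: "real \<Rightarrow> (real \<Rightarrow> real^4) \<Rightarrow> real \<Rightarrow> real" where
  "coord_time c X \<tau> = X \<tau> $ 0 / c"

definition by_coord_time :: "real \<Rightarrow> real set \<Rightarrow> (real \<Rightarrow> real^4) \<Rightarrow> real \<Rightarrow> real^3" where
  "by_coord_time c I X t = spatial (X (the_inv_into I (coord_time c X) t))"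

text \<open>The arguments of the reduced function are \<open>(x\<^sup>0, x\<^sup>\<alpha>, \<epsilon>\<^sup>\<alpha>)\<close> with \<open>x\<^sup>0 = c t\<close>.\<close>

definition reduced :: "(tangent_point \<Rightarrow> real) \<Rightarrow> reduced_point \<Rightarrow> real" where
  "reduced F = (\<lambda>(w, x, \<epsilon>). F (four w x, four 1 \<epsilon>))"

definition reduced_dom :: "tangent_point set \<Rightarrow> reduced_point set" where
  "reduced_dom D = {(w, x, \<epsilon>). (four w x, four 1 \<epsilon>) \<in> D}"

lemma finsler_L_reduced:
  assumes "pos_homogeneous_on D F" "(four w x, four (c * tdot) xdot) \<in> D" "c > 0" "tdot > 0"
  shows "finsler_L F (four w x, four (c * tdot) xdot)
       = c\<^sup>2 * tdot\<^sup>2 * (reduced F (w, x, xdot /\<^sub>R (c * tdot)))\<^sup>2"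
proof -
  let ?\<sigma> = "c * tdot"
  let ?y = "four ?\<sigma> xdot"
  have pos: "?\<sigma> > 0" using assms by simp
  have eq: "four 1 (xdot /\<^sub>R ?\<sigma>) = inverse ?\<sigma> *\<^sub>R ?y"
    using pos unfolding scaleR_four by (metis left_inverse less_irrefl)
  have "F (four w x, inverse ?\<sigma> *\<^sub>R ?y) = inverse ?\<sigma> * F (four w x, ?y)"
    using assms(1,2) pos unfolding pos_homogeneous_on_def by (metis inverse_positive_iff_positive)
  then have "F (four w x, ?y) = ?\<sigma> * reduced F (w, x, xdot /\<^sub>R ?\<sigma>)"
    using assms(3,4) unfolding reduced_def prod.case eq by (simp add: field_simps)
  then show ?thesis by (simp add: finsler_L_def power_mult_distrib)
qed

abbreviation d_x :: "3 \<Rightarrow> (reduced_point \<Rightarrow> real) \<Rightarrow> reduced_point \<Rightarrow> real" where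
  "d_x \<alpha> \<equiv> dir_deriv (0, axis \<alpha> 1, 0)"

text \<open>Derivative in the last argument, which is \<open>\<epsilon>\<close> for \<open>f\<close> and \<open>v\<close> for a Lagrangian.\<close>

abbreviation d_last :: "3 \<Rightarrow> (reduced_point \<Rightarrow> real) \<Rightarrow> reduced_point \<Rightarrow> real" where
  "d_last \<alpha> \<equiv> dir_deriv (0, 0, axis \<alpha> 1)"

definition hess_eps :: "(reduced_point \<Rightarrow> real) \<Rightarrow> reduced_point \<Rightarrow> real^3^3" where
  "hess_eps f p = (\<chi> \<alpha> \<beta>. d_last \<alpha> (d_last \<beta> f) p)"

text \<open>
  \<open>\<partial>\<^sub>t\<close> is the derivative in \<open>t\<close> and not in \<open>x\<^sup>0 = c t\<close>, so it is taken after substituting \<open>c t\<close>.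
\<close>

definition spatial_accel ::
  "real \<Rightarrow> (reduced_point \<Rightarrow> real) \<Rightarrow> reduced_point \<Rightarrow> real^3" where
  "spatial_accel c f = (\<lambda>(t, x, v). let p = (c * t, x, v /\<^sub>R c) in
     (\<chi> \<alpha>. \<Sum>\<beta>\<in>UNIV. matrix_inv (hess_eps f p) $ \<alpha> $ \<beta> *
        (c\<^sup>2 * d_x \<beta> f p
         - c * (deriv (\<lambda>s. d_last \<beta> f (c * s, x, v /\<^sub>R c)) t
                + (\<Sum>\<gamma>\<in>UNIV. v $ \<gamma> * d_x \<gamma> (d_last \<beta> f) p)))))"

definition as_lagrangian ::
  "real \<Rightarrow> (reduced_point \<Rightarrow> real) \<Rightarrow> reduced_point \<Rightarrow> real" where
  "as_lagrangian c f = (\<lambda>(t, x, v). f (c * t, x, v /\<^sub>R c))"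

definition euler_lagrange_at ::
  "(reduced_point \<Rightarrow> real) \<Rightarrow> (real \<Rightarrow> real^3) \<Rightarrow> real \<Rightarrow> bool" where
  "euler_lagrange_at \<Lambda> \<xi> t \<longleftrightarrow>
     (\<forall>\<alpha>. \<exists>m. ((\<lambda>s. d_last \<alpha> \<Lambda> (s, \<xi> s, velocity \<xi> s)) has_real_derivative m) (at t) \<and>
          m - d_x \<alpha> \<Lambda> (t, \<xi> t, velocity \<xi> t) = 0)"

end

theory Submission
  imports Defs
begin

text \<open>
  Write \<open>F\<^sub>b\<close> for velocity derivatives. The geodesic equation is the Euler-Lagrange equation of
  \<open>L = F\<^sup>2\<close>, provided that the metric \<open>g\<^sub>a\<^sub>b = F\<^sub>a F\<^sub>b + F F\<^sub>a\<^sub>b\<close> is invertible. By Euler's relation for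
  homogeneous functions, \<open>F\<^sub>a\<^sub>b\<close> annihilates the velocity \<open>y\<close>, and \<open>g(y, u) = F F\<^sub>b u\<^sup>b\<close>; as the spatial
  block of \<open>F\<^sub>a\<^sub>b\<close> is a multiple of the Hessian of \<open>f\<close>, a vector in the kernel of \<open>g\<close> is a multiple of
  \<open>y\<close>, hence \<open>0\<close>. The equation of \<open>L\<close> implies that of \<open>F\<close>, whose spatial components at the velocity
  \<open>(1, \<epsilon>)\<close> are those of \<open>f\<close>: homogeneity absorbs the rescaling of the velocity and the component of
  the acceleration along it, and these are what the passage to coordinate time removes.
\<close>

section \<open>Directional derivatives of smooth functions\<close>

text \<open>As \<open>S\<close> is open, the Frechet derivative at a point of \<open>S\<close>
  depends only on values in \<open>S\<close>, so the agreement passes to derivatives and the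
  induction goes through.\<close>

lemma C_k_on_cong:
  assumes "open S" "\<And>p. p \<in> S \<Longrightarrow> h p = g p" "C_k_on k h S"
  shows "C_k_on k g S"
  using assms
proof (induction k arbitrary: h g)
  case 0
  then show ?case by (metis C_k_on.simps(1) continuous_on_cong)
next
  case (Suc k)
  have fd: "(h has_derivative frechet_derivative h (at p)) (at p)" if "p \<in> S" for p
    using Suc.prems(3) that by (auto simp: frechet_derivative_works[symmetric])
  have gd: "(g has_derivative frechet_derivative h (at p)) (at p)" if "p \<in> S" for p
    by (rule has_derivative_transform_within_open[OF fd]) (use Suc.prems that in auto)
  have eq: "frechet_derivative h (at p) = frechet_derivative g (at p)" if "p \<in> S" for p
    using frechet_derivative_at[OF gd[OF that]] .
  have "C_k_on k (\<lambda>p. frechet_derivative g (at p) v) S" for v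
    by (rule Suc.IH[where h = "\<lambda>p. frechet_derivative h (at p) v"]) (use Suc.prems eq in auto)
  then show ?case using gd by (auto simp: differentiable_def)
qed

text \<open>\<open>A\<close> has the same derivative \<open>B\<close> everywhere, so differentiating
  the composite along \<open>v\<close> gives the derivative of \<open>h\<close> along the fixed
  vector \<open>B v\<close>, composed with \<open>A\<close>. The induction hypothesis applies to it
  without a product rule.\<close>

lemma C_k_on_compose_affine:
  assumes "open S" "\<And>p. (A has_derivative B) (at p)" "C_k_on k h S"
  shows "C_k_on k (\<lambda>p. h (A p)) (A -` S)"
  using assms(3)
proof (induction k arbitrary: h)
  case 0
  have "continuous_on (A -` S) A"
    by (intro continuous_at_imp_continuous_on ballI has_derivative_continuous[OF assms(2)])
  then show ?case using 0 by (auto intro: continuous_on_compose2)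
next
  case (Suc k)
  have contA: "continuous_on UNIV A"
    by (intro continuous_at_imp_continuous_on ballI has_derivative_continuous[OF assms(2)])
  then have op: "open (A -` S)" using assms(1) by (simp add: continuous_on_open_vimage)
  have d: "((\<lambda>q. h (A q)) has_derivative (\<lambda>v. frechet_derivative h (at (A p)) (B v))) (at p)"
    if "p \<in> A -` S" for p
  proof -
    have "(h has_derivative frechet_derivative h (at (A p))) (at (A p))"
      using Suc.prems that by (auto simp: frechet_derivative_works[symmetric])
    from has_derivative_compose[OF assms(2) this] show ?thesis by simp
  qed
  have "C_k_on k (\<lambda>p. frechet_derivative (\<lambda>q. h (A q)) (at p) v) (A -` S)" for v
  proof (rule C_k_on_cong[OF op])
    show "C_k_on k (\<lambda>p. frechet_derivative h (at (A p)) (B v)) (A -` S)"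
      using Suc.IH[of "\<lambda>p. frechet_derivative h (at p) (B v)"] Suc.prems by simp
    show "frechet_derivative h (at (A p)) (B v) = frechet_derivative (\<lambda>q. h (A q)) (at p) v"
      if "p \<in> A -` S" for p
      using frechet_derivative_at[OF d[OF that]] by metis
  qed
  then show ?case using d by (auto simp: differentiable_def)
qed

lemma smooth_on_compose_affine:
  assumes "open S" "\<And>p. (A has_derivative B) (at p)" "smooth_on h S"
  shows "smooth_on (\<lambda>p. h (A p)) (A -` S)"
  using C_k_on_compose_affine[OF assms(1,2)] assms(3) by (simp add: smooth_on_def)

section \<open>Calculus of directional derivatives\<close>

lemma dir_deriv_eqI:
  assumes "(h has_derivative h') (at p)"
  shows "dir_deriv v h p = h' v"
proof -
  have "((\<lambda>s. p + s *\<^sub>R v) has_derivative (\<lambda>s. s *\<^sub>R v)) (at 0)"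
    by (auto intro!: derivative_eq_intros)
  moreover have "(h has_derivative h') (at (p + 0 *\<^sub>R v))" using assms by simp
  ultimately have "((\<lambda>s. h (p + s *\<^sub>R v)) has_derivative (\<lambda>s. h' (s *\<^sub>R v))) (at 0)"
    by (rule has_derivative_compose)
  moreover have "h' (s *\<^sub>R v) = s * h' v" for s
    using linear_scale[OF has_derivative_linear[OF assms]] by simp
  ultimately have "((\<lambda>s. h (p + s *\<^sub>R v)) has_field_derivative h' v) (at 0)"
    by (simp add: has_field_derivative_def mult_commute_abs)
  then show ?thesis unfolding dir_deriv_def by (rule DERIV_imp_deriv)
qed

text \<open>Directional derivatives are local. This admits formulas that are known only on an open
  set such as \<open>D\<close>.\<close>

lemma dir_deriv_cong:
  assumes "open S" "p \<in> S" "\<And>q. q \<in> S \<Longrightarrow> h q = g q"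
  shows "dir_deriv v h p = dir_deriv v g p"
  unfolding dir_deriv_def
proof (rule deriv_cong_ev)
  have "((\<lambda>s. p + s *\<^sub>R v) \<longlongrightarrow> p + 0 *\<^sub>R v) (nhds 0)"
    by (intro tendsto_intros filterlim_ident)
  then have "((\<lambda>s. p + s *\<^sub>R v) \<longlongrightarrow> p) (nhds 0)" by simp
  then have "\<forall>\<^sub>F s in nhds 0. p + s *\<^sub>R v \<in> S"
    using assms(1,2) by (auto dest: topological_tendstoD)
  then show "\<forall>\<^sub>F s in nhds 0. h (p + s *\<^sub>R v) = g (p + s *\<^sub>R v)"
    by eventually_elim (use assms(3) in auto)
qed simp

lemma smooth_on_has_derivative:
  assumes "smooth_on h S" "p \<in> S"
  shows "(h has_derivative (\<lambda>v. dir_deriv v h p)) (at p)"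
proof -
  have "C_k_on (Suc 0) h S" using assms(1) unfolding smooth_on_def by blast
  then have "(h has_derivative frechet_derivative h (at p)) (at p)"
    using assms(2) by (auto simp: frechet_derivative_works[symmetric])
  then show ?thesis
    using dir_deriv_eqI by (metis (no_types, lifting) ext)
qed

lemma smooth_on_dir_deriv:
  assumes "open S" "smooth_on h S"
  shows "smooth_on (dir_deriv v h) S"
  unfolding smooth_on_def
proof
  fix k
  have "C_k_on (Suc k) h S" using assms(2) unfolding smooth_on_def by blast
  then have "C_k_on k (\<lambda>p. frechet_derivative h (at p) v) S" by simp
  then show "C_k_on k (dir_deriv v h) S"
  proof (rule C_k_on_cong[OF assms(1), rotated])
    show "frechet_derivative h (at p) v = dir_deriv v h p" if "p \<in> S" for p
      using frechet_derivative_at[OF smooth_on_has_derivative[OF assms(2) that]] by metis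
  qed
qed

lemma smooth_on_imp_continuous_on: "smooth_on h S \<Longrightarrow> continuous_on S h"
  unfolding smooth_on_def by (metis C_k_on.simps(1))

lemma linear_dir_deriv:
  assumes "smooth_on h S" "p \<in> S"
  shows "linear (\<lambda>v. dir_deriv v h p)"
  using has_derivative_linear[OF smooth_on_has_derivative[OF assms]] .

lemma smooth_on_has_derivative_curve:
  assumes "smooth_on h S" "\<gamma> t \<in> S" "(\<gamma> has_vector_derivative \<gamma>') (at t)"
  shows "((\<lambda>s. h (\<gamma> s)) has_real_derivative dir_deriv \<gamma>' h (\<gamma> t)) (at t)"
  using has_derivative_compose[OF assms(3)[unfolded has_vector_derivative_def]
      smooth_on_has_derivative[OF assms(1,2)]]
    linear_scale[OF linear_dir_deriv[OF assms(1,2)]]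
  by (simp add: has_field_derivative_def mult_commute_abs)

lemma smooth_on_has_derivative_line:
  assumes "smooth_on h S" "p + s *\<^sub>R u \<in> S"
  shows "((\<lambda>s. h (p + s *\<^sub>R u)) has_real_derivative dir_deriv u h (p + s *\<^sub>R u)) (at s)"
  by (rule smooth_on_has_derivative_curve[OF assms(1), where \<gamma> = "\<lambda>s. p + s *\<^sub>R u"])
    (use assms(2) in \<open>auto intro!: derivative_eq_intros\<close>)

section \<open>Symmetry of second derivatives\<close>

text \<open>Two mean value arguments: first for the increment along \<open>v\<close> while its base
  point moves along \<open>u\<close>, then for the resulting difference of derivatives along
  \<open>v\<close>. The bound on \<open>t\<close> keeps the whole parallelogram in the ball.\<close>

lemma second_difference_mean_value:
  fixes p :: "'a::real_normed_vector"
  assumes h: "smooth_on h S" and S: "open S" and B: "ball p r \<subseteq> S"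
    and t: "t > 0" "t * (norm u + norm v) < r"
  shows "\<exists>q\<in>ball p r. h (p + t *\<^sub>R u + t *\<^sub>R v) - h (p + t *\<^sub>R u) - (h (p + t *\<^sub>R v) - h p)
           = t\<^sup>2 * dir_deriv v (dir_deriv u h) q"
proof -
  have near: "p + \<sigma> *\<^sub>R u + \<tau> *\<^sub>R v \<in> ball p r" if "0 \<le> \<sigma>" "\<sigma> \<le> t" "0 \<le> \<tau>" "\<tau> \<le> t" for \<sigma> \<tau>
  proof -
    have "norm (\<sigma> *\<^sub>R u + \<tau> *\<^sub>R v) \<le> \<sigma> * norm u + \<tau> * norm v"
      using norm_triangle_ineq[of "\<sigma> *\<^sub>R u" "\<tau> *\<^sub>R v"] that by simp
    also have "\<dots> \<le> t * norm u + t * norm v"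
      using that by (intro add_mono mult_right_mono) auto
    also have "\<dots> < r" using t by (simp add: algebra_simps)
    finally have "dist (p + (\<sigma> *\<^sub>R u + \<tau> *\<^sub>R v)) p < r" by (simp add: dist_norm)
    then show ?thesis by (simp add: dist_commute add.assoc)
  qed
  let ?\<psi> = "\<lambda>s. h (p + t *\<^sub>R v + s *\<^sub>R u) - h (p + s *\<^sub>R u)"
  have d\<psi>: "(?\<psi> has_real_derivative
        dir_deriv u h (p + t *\<^sub>R v + s *\<^sub>R u) - dir_deriv u h (p + s *\<^sub>R u)) (at s)"
    if "0 \<le> s" "s \<le> t" for s
    using near[of s t] near[of s 0] B that t
    by (intro DERIV_diff smooth_on_has_derivative_line[OF h]) (auto simp: algebra_simps)
  obtain s where s: "0 < s" "s < t" and eq1: "?\<psi> t - ?\<psi> 0 =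
      (t - 0) * (dir_deriv u h (p + t *\<^sub>R v + s *\<^sub>R u) - dir_deriv u h (p + s *\<^sub>R u))"
    using MVT2[OF t(1) d\<psi>] by auto
  have d2: "((\<lambda>\<tau>. dir_deriv u h (p + s *\<^sub>R u + \<tau> *\<^sub>R v)) has_real_derivative
        dir_deriv v (dir_deriv u h) (p + s *\<^sub>R u + \<tau> *\<^sub>R v)) (at \<tau>)"
    if "0 \<le> \<tau>" "\<tau> \<le> t" for \<tau>
    using near[of s \<tau>] B that s
    by (intro smooth_on_has_derivative_line[OF smooth_on_dir_deriv[OF S h]]) auto
  obtain \<tau> where \<tau>: "0 < \<tau>" "\<tau> < t" and eq2:
    "dir_deriv u h (p + s *\<^sub>R u + t *\<^sub>R v) - dir_deriv u h (p + s *\<^sub>R u + 0 *\<^sub>R v)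
      = (t - 0) * dir_deriv v (dir_deriv u h) (p + s *\<^sub>R u + \<tau> *\<^sub>R v)"
    using MVT2[OF t(1) d2] by auto
  show ?thesis
  proof (rule bexI)
    show "p + s *\<^sub>R u + \<tau> *\<^sub>R v \<in> ball p r" using near s \<tau> by simp
    show "h (p + t *\<^sub>R u + t *\<^sub>R v) - h (p + t *\<^sub>R u) - (h (p + t *\<^sub>R v) - h p)
           = t\<^sup>2 * dir_deriv v (dir_deriv u h) (p + s *\<^sub>R u + \<tau> *\<^sub>R v)"
      using eq1 eq2 by (simp add: algebra_simps power2_eq_square)
  qed
qed

text \<open>The second difference is symmetric in \<open>u\<close> and \<open>v\<close>, so in a
  small ball both mixed derivatives attain a common value, possibly at different points. Continuity
  at \<open>p\<close> then excludes a gap.\<close>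

lemma dir_deriv_commute:
  fixes p :: "'a::real_normed_vector"
  assumes S: "open S" and h: "smooth_on h S" and p: "p \<in> S"
  shows "dir_deriv u (dir_deriv v h) p = dir_deriv v (dir_deriv u h) p"
proof (rule ccontr)
  let ?a = "\<lambda>p. dir_deriv u (dir_deriv v h) p" and ?b = "\<lambda>p. dir_deriv v (dir_deriv u h) p"
  assume ne: "?a p \<noteq> ?b p"
  define e where "e = \<bar>?a p - ?b p\<bar> / 2"
  have e: "e > 0" using ne by (simp add: e_def)
  have "isCont ?a p" "isCont ?b p"
    using smooth_on_imp_continuous_on[OF smooth_on_dir_deriv[OF S smooth_on_dir_deriv[OF S h]]] S p
    by (auto simp: continuous_on_eq_continuous_at)
  then obtain r1 r2 where r1: "r1 > 0" "\<And>q. dist q p < r1 \<Longrightarrow> dist (?a q) (?a p) < e"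
    and r2: "r2 > 0" "\<And>q. dist q p < r2 \<Longrightarrow> dist (?b q) (?b p) < e"
    using e unfolding continuous_at_eps_delta by (metis dist_commute)
  obtain r3 where r3: "r3 > 0" "ball p r3 \<subseteq> S" using S p openE by blast
  define r where "r = min r1 (min r2 r3)"
  have r: "r > 0" "ball p r \<subseteq> S" using r1(1) r2(1) r3 by (auto simp: r_def)
  \<comment> \<open>The summand \<open>1\<close> keeps the denominator positive when both vectors
    vanish and makes the bound \<open>t * (norm u + norm v) < r\<close> strict.\<close>
  define t where "t = r / (norm u + norm v + 1)"
  have t: "t > 0" using r by (simp add: t_def add_nonneg_pos)
  have "t * (norm u + norm v + 1) = r" by (simp add: t_def add_nonneg_pos less_imp_neq[symmetric])
  then have tr: "t * (norm u + norm v) < r" using t by (simp add: algebra_simps)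
  obtain q1 where q1: "q1 \<in> ball p r"
    "h (p + t *\<^sub>R u + t *\<^sub>R v) - h (p + t *\<^sub>R u) - (h (p + t *\<^sub>R v) - h p) = t\<^sup>2 * ?b q1"
    using second_difference_mean_value[OF h S r(2) t tr] by auto
  obtain q2 where q2: "q2 \<in> ball p r"
    "h (p + t *\<^sub>R v + t *\<^sub>R u) - h (p + t *\<^sub>R v) - (h (p + t *\<^sub>R u) - h p) = t\<^sup>2 * ?a q2"
    using second_difference_mean_value[OF h S r(2) t, of v u] tr by (auto simp: algebra_simps)
  have "t\<^sup>2 * ?b q1 = t\<^sup>2 * ?a q2" using q1(2) q2(2) by (simp add: algebra_simps)
  then have "?b q1 = ?a q2" using t by simp
  moreover have "dist (?b q1) (?b p) < e"
    using q1(1) by (intro r2(2)) (simp add: r_def dist_commute)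
  moreover have "dist (?a q2) (?a p) < e"
    using q2(1) by (intro r1(2)) (simp add: r_def dist_commute)
  ultimately show False unfolding e_def dist_real_def by (smt (verit) field_sum_of_halves)
qed

text \<open>Linearity in the inner direction comes from symmetry, which turns it into the outer
  direction.\<close>

lemma linear_dir_deriv2:
  assumes "open S" "smooth_on h S" "p \<in> S"
  shows "linear (\<lambda>u. dir_deriv u (dir_deriv v h) p)" "linear (\<lambda>v. dir_deriv u (dir_deriv v h) p)"
proof -
  show lin: "linear (\<lambda>u. dir_deriv u (dir_deriv v h) p)" for v
    by (rule linear_dir_deriv[OF smooth_on_dir_deriv[OF assms(1,2)] assms(3)])
  show "linear (\<lambda>v. dir_deriv u (dir_deriv v h) p)"
    using lin[of u] by (simp only: dir_deriv_commute[OF assms, of u])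
qed

section \<open>Linear algebra\<close>

text \<open>The link between indices and directions: it turns index sums into one derivative along a
  vector and extends identities from axis vectors to all vectors.\<close>

lemma linear_eq_sum_axis:
  fixes g :: "real^'n \<Rightarrow> real"
  assumes "linear g"
  shows "g u = (\<Sum>b\<in>UNIV. u $ b * g (axis b 1))"
proof -
  have "g u = g (\<Sum>b\<in>UNIV. u $ b *\<^sub>R axis b 1)"
    using basis_expansion[of u] by (simp add: scalar_mult_eq_scaleR)
  then show ?thesis using assms by (simp add: linear_sum linear_scale)
qed

lemma linear_compose_Pair:
  assumes "linear g"
  shows "linear (\<lambda>w. g (0, w))" "linear (\<lambda>z. g (z, 0))"
  using linear_compose[OF _ assms, of "\<lambda>w. (0, w)"] linear_compose[OF _ assms, of "\<lambda>z. (z, 0)"]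
  by (auto simp: o_def linear_iff)

lemma linear_Pair_split:
  assumes "linear g"
  shows "g (z, w) = g (z, 0) + g (0, w)"
  using linear_add[OF assms, of "(z, 0)" "(0, w)"] by simp

lemma matrix_inv_mult:
  fixes A :: "real^'n^'n"
  assumes "invertible A"
  shows "A ** matrix_inv A = mat 1" "matrix_inv A ** A = mat 1"
  using someI_ex[OF assms[unfolded invertible_def]] by (auto simp: matrix_inv_def)

text \<open>Replaces the inverse matrices in \<open>spray\<close> and \<open>spatial_accel\<close>
  by linear equations.\<close>

lemma matrix_inv_vector_eq_iff:
  fixes A :: "real^'n^'n"
  assumes "invertible A"
  shows "u = matrix_inv A *v w \<longleftrightarrow> A *v u = w"
  using matrix_inv_mult[OF assms]
  by (metis matrix_vector_mul_assoc matrix_vector_mul_lid)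

lemma four_add: "four w x + four w' x' = four (w + w') (x + x')"
proof -
  have "(four w x + four w' x') $ i = four (w + w') (x + x') $ i" for i :: 4
    using exhaust_4[of i] by (auto simp: four_nth)
  then show ?thesis by (simp add: vec_eq_iff)
qed

lemma spatial_add: "spatial (x + y) = spatial x + spatial y"
  by (simp add: spatial_def vec_eq_iff)

lemma spatial_diff: "spatial (x - y) = spatial x - spatial y"
  by (simp add: spatial_def vec_eq_iff)

lemma spatial_scaleR: "spatial (r *\<^sub>R x) = r *\<^sub>R spatial x"
  by (simp add: spatial_def vec_eq_iff)

lemma four_0_0: "four 0 0 = 0"
  using four_spatial[of 0] by (simp add: spatial_def zero_vec_def)

lemma linear_four: "linear (four 0)"
  by (rule linearI) (simp_all add: four_add scaleR_four)

section \<open>Finsler geodesics\<close>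

text \<open>Differentiate the scaling identity; the chain rule puts \<open>\<sigma>\<close> on the
  velocity direction. \<open>k\<close> is separate from \<open>\<sigma>\<close> to serve degree one
  (\<open>k = \<sigma>\<close>) and degree zero (\<open>k = 1\<close>).\<close>

lemma dir_deriv_homogeneous:
  assumes "open D" "smooth_on h D" "(x, y) \<in> D"
    and hom: "\<And>x y. (x, y) \<in> D \<Longrightarrow> (x, \<sigma> *\<^sub>R y) \<in> D \<and> h (x, \<sigma> *\<^sub>R y) = k * h (x, y)"
  shows "dir_deriv (z, \<sigma> *\<^sub>R w) h (x, \<sigma> *\<^sub>R y) = k * dir_deriv (z, w) h (x, y)"
proof -
  have "((\<lambda>p. (fst p, \<sigma> *\<^sub>R snd p)) has_derivative (\<lambda>v. (fst v, \<sigma> *\<^sub>R snd v))) (at (x, y))"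
    by (auto intro!: derivative_eq_intros)
  moreover have "(h has_derivative (\<lambda>v. dir_deriv v h (x, \<sigma> *\<^sub>R y)))
      (at (fst (x, y), \<sigma> *\<^sub>R snd (x, y)))"
    using smooth_on_has_derivative[OF assms(2)] hom assms(3) by simp
  ultimately have "dir_deriv (z, w) (\<lambda>p. h (fst p, \<sigma> *\<^sub>R snd p)) (x, y)
      = dir_deriv (z, \<sigma> *\<^sub>R w) h (x, \<sigma> *\<^sub>R y)"
    using dir_deriv_eqI[OF has_derivative_compose] by fastforce
  moreover have "dir_deriv (z, w) (\<lambda>p. h (fst p, \<sigma> *\<^sub>R snd p)) (x, y)
      = dir_deriv (z, w) (\<lambda>p. k * h p) (x, y)"
    by (rule dir_deriv_cong[OF assms(1,3)]) (use hom in auto)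
  moreover have "dir_deriv (z, w) (\<lambda>p. k * h p) (x, y) = k * dir_deriv (z, w) h (x, y)"
    by (rule dir_deriv_eqI[OF has_derivative_mult_right])
      (rule smooth_on_has_derivative[OF assms(2,3)])
  ultimately show ?thesis by simp
qed

text \<open>Euler's relation: differentiate at \<open>s = 0\<close> along the ray with scaling
  factor \<open>1 + s\<close>, which is positive for \<open>s\<close> near \<open>0\<close>.\<close>

lemma euler_homogeneous:
  assumes "\<And>\<sigma>. \<sigma> > 0 \<Longrightarrow> h (x, \<sigma> *\<^sub>R y) = \<sigma> ^ n * h (x, y)"
  shows "dir_deriv (0, y) h (x, y) = real n * h (x, y)"
proof -
  have "\<forall>\<^sub>F s in nhds (0::real). s > - 1"
    by (rule order_tendstoD[OF filterlim_ident]) simp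
  then have "\<forall>\<^sub>F s in nhds 0. h ((x, y) + s *\<^sub>R (0, y)) = (1 + s) ^ n * h (x, y)"
  proof eventually_elim
    case (elim s)
    then show ?case using assms[of "1 + s"] by (simp add: algebra_simps)
  qed
  then have "dir_deriv (0, y) h (x, y) = deriv (\<lambda>s. (1 + s) ^ n * h (x, y)) 0"
    unfolding dir_deriv_def by (intro deriv_cong_ev) auto
  also have "\<dots> = real n * h (x, y)"
    by (rule DERIV_imp_deriv) (auto intro!: derivative_eq_intros)
  finally show ?thesis .
qed

text \<open>Both sides differentiate along the same line, because the embedding is affine with
  linear part \<open>four 0\<close> on the last argument. As an equation between functions it can be
  iterated.\<close>

lemma dir_deriv_reduced:
  "dir_deriv (w, x, e) (reduced F) = reduced (dir_deriv (four w x, four 0 e) F)"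
  by (auto simp: dir_deriv_def reduced_def fun_eq_iff four_add scaleR_four)

lemma dir_deriv_finsler_L:
  assumes "smooth_on F D" "p \<in> D"
  shows "dir_deriv v (finsler_L F) p = 2 * F p * dir_deriv v F p"
proof -
  have "(finsler_L F has_derivative (\<lambda>v. 2 * F p * dir_deriv v F p)) (at p)"
    unfolding finsler_L_def
    by (auto intro!: derivative_eq_intros smooth_on_has_derivative[OF assms])
  then show ?thesis by (rule dir_deriv_eqI)
qed

text \<open>Product rule. The directions are arbitrary pairs, so this covers the metric as well as
  the mixed derivatives in the spray.\<close>

lemma dir_deriv2_finsler_L:
  assumes "open D" "smooth_on F D" "p \<in> D"
  shows "dir_deriv u (dir_deriv v (finsler_L F)) p
    = 2 * (dir_deriv u F p * dir_deriv v F p + F p * dir_deriv u (dir_deriv v F) p)"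
proof -
  have "dir_deriv u (dir_deriv v (finsler_L F)) p = dir_deriv u (\<lambda>p. 2 * F p * dir_deriv v F p) p"
    by (rule dir_deriv_cong[OF assms(1,3)]) (rule dir_deriv_finsler_L[OF assms(2)])
  also have "\<dots> = 2 * F p * dir_deriv u (dir_deriv v F) p + 2 * dir_deriv u F p * dir_deriv v F p"
    by (rule dir_deriv_eqI) (auto intro!: derivative_eq_intros
        smooth_on_has_derivative[OF assms(2,3)]
        smooth_on_has_derivative[OF smooth_on_dir_deriv[OF assms(1,2)] assms(3)])
  finally show ?thesis by (simp add: algebra_simps)
qed

lemma linear_dir_deriv2_Pair:
  assumes "open D" "smooth_on h D" "p \<in> D"
  shows "linear (\<lambda>w. dir_deriv u (dir_deriv (0, w) h) p)"
    "linear (\<lambda>w. dir_deriv (0, w) (dir_deriv v h) p)"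
  using linear_compose_Pair[OF linear_dir_deriv2(1)[OF assms]]
    linear_compose_Pair[OF linear_dir_deriv2(2)[OF assms]] by auto

section \<open>Geometry of a conic Finsler function\<close>

text \<open>Nondegeneracy is imposed at the velocities \<open>(1, \<epsilon>)\<close>; homogeneity
  carries it to all velocities with positive time component.\<close>

locale conic_finsler =
  fixes D :: "tangent_point set" and F :: "tangent_point \<Rightarrow> real"
  assumes open_D: "open D" and smooth: "smooth_on F D" and hom: "pos_homogeneous_on D F"
    and reduced_nonzero: "\<And>q. q \<in> reduced_dom D \<Longrightarrow> reduced F q \<noteq> 0"
    and hess_invertible: "\<And>q. q \<in> reduced_dom D \<Longrightarrow> invertible (hess_eps (reduced F) q)"
begin

lemmas linear1 = linear_dir_deriv[OF smooth]
lemmas linear1_Pair = linear_compose_Pair[OF linear1]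
lemmas linear2_Pair = linear_dir_deriv2_Pair[OF open_D smooth]
lemmas commute2 = dir_deriv_commute[OF open_D smooth]

lemma scale:
  assumes "(x, y) \<in> D" "\<sigma> > 0"
  shows "(x, \<sigma> *\<^sub>R y) \<in> D" "F (x, \<sigma> *\<^sub>R y) = \<sigma> * F (x, y)"
  using assms hom unfolding pos_homogeneous_on_def by auto

lemma scale_d_pos:
  assumes "(x, y) \<in> D" "\<sigma> > 0"
  shows "dir_deriv (z, 0) F (x, \<sigma> *\<^sub>R y) = \<sigma> * dir_deriv (z, 0) F (x, y)"
  using dir_deriv_homogeneous[OF open_D smooth assms(1), of \<sigma> \<sigma> z 0] scale assms(2) by simp

text \<open>A velocity derivative lowers the degree from one to zero: the factor on the direction
  cancels the factor on the value.\<close>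

lemma scale_d_vel:
  assumes "(x, y) \<in> D" "\<sigma> > 0"
  shows "dir_deriv (0, w) F (x, \<sigma> *\<^sub>R y) = dir_deriv (0, w) F (x, y)"
proof -
  have "dir_deriv (0, \<sigma> *\<^sub>R w) F (x, \<sigma> *\<^sub>R y) = \<sigma> * dir_deriv (0, w) F (x, y)"
    using dir_deriv_homogeneous[OF open_D smooth assms(1), of \<sigma> \<sigma> 0 w] scale assms(2) by simp
  then show ?thesis
    using linear_scale[OF linear1_Pair(1)[OF scale(1)[OF assms]], of \<sigma> w] assms(2) by simp
qed

lemma scale_d_d_vel:
  assumes "(x, y) \<in> D" "\<sigma> > 0"
  shows "dir_deriv (z, \<sigma> *\<^sub>R a) (dir_deriv (0, w) F) (x, \<sigma> *\<^sub>R y)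
    = dir_deriv (z, a) (dir_deriv (0, w) F) (x, y)"
  using dir_deriv_homogeneous[OF open_D smooth_on_dir_deriv[OF open_D smooth] assms(1), of \<sigma> _ 1 z a]
    scale(1) scale_d_vel assms(2) by simp

text \<open>Degree one for \<open>F\<close> and its position derivatives, degree zero for its
  velocity derivatives.\<close>

lemma euler:
  assumes "(x, y) \<in> D"
  shows "dir_deriv (0, y) F (x, y) = F (x, y)"
    and "dir_deriv (0, y) (dir_deriv (z, 0) F) (x, y) = dir_deriv (z, 0) F (x, y)"
    and "dir_deriv (0, y) (dir_deriv (0, w) F) (x, y) = 0"
  using euler_homogeneous[of F x y 1] euler_homogeneous[of "dir_deriv (z, 0) F" x y 1]
    euler_homogeneous[of "dir_deriv (0, w) F" x y 0] scale(2) scale_d_pos scale_d_vel assms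
  by simp_all

text \<open>Identifies the Hessian of \<open>f\<close> with the spatial block of the velocity
  Hessian of \<open>F\<close>, through which its invertibility reaches the metric.\<close>

lemma hess_reduced_mult:
  assumes "(w, x, \<epsilon>) \<in> reduced_dom D"
  shows "(hess_eps (reduced F) (w, x, \<epsilon>) *v \<omega>) $ \<alpha> =
    dir_deriv (0, four 0 (axis \<alpha> 1)) (dir_deriv (0, four 0 \<omega>) F) (four w x, four 1 \<epsilon>)"
proof -
  have D: "(four w x, four 1 \<epsilon>) \<in> D" using assms by (simp add: reduced_dom_def)
  have "linear (\<lambda>\<omega>. dir_deriv (0, four 0 (axis \<alpha> 1)) (dir_deriv (0, four 0 \<omega>) F) (four w x, four 1 \<epsilon>))"
    using linear_compose[OF linear_four linear2_Pair(1)[OF D]] by (simp add: o_def)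
  from linear_eq_sum_axis[OF this, of \<omega>] show ?thesis
    by (simp add: matrix_vector_mult_def hess_eps_def dir_deriv_reduced four_0_0 mult.commute)
      (simp add: reduced_def)
qed

lemma finsler_metric_mult:
  assumes "p \<in> D"
  shows "(finsler_metric (finsler_L F) p *v u) $ a
    = 1/2 * dir_deriv (0, axis a 1) (dir_deriv (0, u) (finsler_L F)) p"
proof -
  have "linear (\<lambda>u. 1/2 * dir_deriv (0, axis a 1) (dir_deriv (0, u) (finsler_L F)) p)"
    using linear1_Pair(1)[OF assms] linear2_Pair(1)[OF assms]
    by (simp add: dir_deriv2_finsler_L[OF open_D smooth assms] linear_iff algebra_simps)
  from linear_eq_sum_axis[OF this, of u] show ?thesis
    by (simp add: matrix_vector_mult_def finsler_metric_def mult.commute)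
qed

lemma reduced_point_in_dom:
  assumes "(x, y) \<in> D" "y $ 0 > 0"
  shows "(x $ 0, spatial x, spatial y /\<^sub>R (y $ 0)) \<in> reduced_dom D"
    and "four 1 (spatial y /\<^sub>R (y $ 0)) = y /\<^sub>R (y $ 0)"
proof -
  have "y /\<^sub>R (y $ 0) = inverse (y $ 0) *\<^sub>R four (y $ 0) (spatial y)"
    by simp
  also have "\<dots> = four 1 (spatial y /\<^sub>R (y $ 0))"
    using assms(2) unfolding scaleR_four by simp
  finally show "four 1 (spatial y /\<^sub>R (y $ 0)) = y /\<^sub>R (y $ 0)" by simp
  then show "(x $ 0, spatial x, spatial y /\<^sub>R (y $ 0)) \<in> reduced_dom D"
    using scale(1)[OF assms(1), of "inverse (y $ 0)"] assms(2) by (simp add: reduced_dom_def)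
qed

lemma nonzero:
  assumes "(x, y) \<in> D" "y $ 0 > 0"
  shows "F (x, y) \<noteq> 0"
proof -
  have "F (x, y /\<^sub>R (y $ 0)) \<noteq> 0"
    using reduced_nonzero[OF reduced_point_in_dom(1)[OF assms]] reduced_point_in_dom(2)[OF assms]
    by (simp add: reduced_def)
  then show ?thesis
    using scale(2)[OF assms(1), of "inverse (y $ 0)"] assms(2) by simp
qed

lemma finsler_metric_invertible:
  assumes D: "(x, y) \<in> D" and pos: "y $ 0 > 0"
  shows "invertible (finsler_metric (finsler_L F) (x, y))"
  unfolding invertible_left_inverse matrix_left_invertible_ker
proof (intro allI impI)
  let ?F2 = "\<lambda>w u. dir_deriv (0, w) (dir_deriv (0, u) F) (x, y)"
  fix u assume "finsler_metric (finsler_L F) (x, y) *v u = 0"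
  then have "dir_deriv (0, axis a 1) (dir_deriv (0, u) (finsler_L F)) (x, y) = 0" for a
    using finsler_metric_mult[OF D, of u a] by simp
  then have axis0: "dir_deriv (0, axis a 1) F (x, y) * dir_deriv (0, u) F (x, y)
      + F (x, y) * ?F2 (axis a 1) u = 0" for a
    using dir_deriv2_finsler_L[OF open_D smooth D, of "(0, axis a 1)" "(0, u)"] by simp
  have lin: "linear (\<lambda>w. dir_deriv (0, w) F (x, y) * dir_deriv (0, u) F (x, y) + F (x, y) * ?F2 w u)"
    using linear1_Pair(1)[OF D] linear2_Pair(2)[OF D] by (simp add: linear_iff algebra_simps)
  have all0: "dir_deriv (0, w) F (x, y) * dir_deriv (0, u) F (x, y) + F (x, y) * ?F2 w u = 0" for w
    using linear_eq_sum_axis[OF lin, of w] axis0 by simp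
  \<comment> \<open>Testing with \<open>w = y\<close> removes the second derivative by Euler's
    relation and leaves a nonzero multiple of the wanted derivative.\<close>
  have u0: "dir_deriv (0, u) F (x, y) = 0"
    using all0[of y] euler[OF D] nonzero[OF D pos] by simp
  then have F2: "?F2 w u = 0" for w using all0[of w] nonzero[OF D pos] by simp
  let ?\<sigma> = "y $ 0" let ?r = "u $ 0 / y $ 0"
  \<comment> \<open>The multiple of \<open>y\<close> cancels the time component, so
    \<open>u'\<close> is purely spatial; \<open>?F2\<close> is unaffected because it annihilates
    \<open>y\<close>.\<close>
  define u' where "u' = u - ?r *\<^sub>R y"
  let ?q = "(x $ 0, spatial x, spatial y /\<^sub>R ?\<sigma>)"
  have u'0: "four 0 (spatial u') = u'"
    using four_spatial[of u'] pos by (simp add: u'_def)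
  have "?F2 w y = 0" for w
    using commute2[OF D, of "(0, w)" "(0, y)"] euler(3)[OF D] by simp
  then have "?F2 w u' = 0" for w
    using F2 linear_diff[OF linear2_Pair(1)[OF D, of "(0, w)"], of u "?r *\<^sub>R y"]
      linear_scale[OF linear2_Pair(1)[OF D, of "(0, w)"], of ?r y]
    by (simp add: u'_def)
  then have "dir_deriv (0, w) (dir_deriv (0, u') F) (x, y /\<^sub>R ?\<sigma>) = 0" for w
    using scale_d_d_vel[OF D, of "inverse ?\<sigma>" 0 "?\<sigma> *\<^sub>R w" u'] pos by simp
  then have "(hess_eps (reduced F) ?q *v spatial u') $ \<alpha> = 0" for \<alpha>
    using hess_reduced_mult[OF reduced_point_in_dom(1)[OF assms]] u'0 reduced_point_in_dom(2)[OF assms]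
    by simp
  then have "hess_eps (reduced F) ?q *v spatial u' = 0"
    by (simp add: vec_eq_iff)
  then have "spatial u' = 0"
    using hess_invertible[OF reduced_point_in_dom(1)[OF assms]]
    unfolding invertible_left_inverse matrix_left_invertible_ker by blast
  then have "u = ?r *\<^sub>R y" using u'0 by (simp add: u'_def four_0_0)
  \<comment> \<open>The direction \<open>y\<close> is left to exclude: there the first derivative of
    \<open>F\<close> is \<open>F\<close> itself, and \<open>u0\<close> makes it vanish.\<close>
  moreover from this have "?r * F (x, y) = 0"
    using u0 euler(1)[OF D] linear_scale[OF linear1_Pair(1)[OF D], of ?r y] by simp
  ultimately show "u = 0" using nonzero[OF D pos] by auto
qed

text \<open>
  Contracting the Euler-Lagrange equation of \<open>F\<^sup>2\<close> with the velocity shows that \<open>F\<close> is constant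
  along the geodesic, so that the Euler-Lagrange equation of \<open>F\<close> holds as well.
\<close>

lemma geodesic_imp_euler_lagrange_F:
  assumes D: "(x, y) \<in> D" and pos: "y $ 0 > 0"
    and geo: "A + 2 *\<^sub>R spray (finsler_L F) (x, y) = 0"
  shows "dir_deriv (y, A) (dir_deriv (0, w) F) (x, y) = dir_deriv (w, 0) F (x, y)"
proof -
  let ?L = "finsler_L F" and ?p = "(x, y)"
  note L1 = dir_deriv_finsler_L[OF smooth D] and L2 = dir_deriv2_finsler_L[OF open_D smooth D]
  \<comment> \<open>The Euler-Lagrange expression of \<open>L\<close> without its acceleration term;
    twice the spray is half of the inverse metric applied to it.\<close>
  define E where "E = (\<chi> b. (\<Sum>c\<in>UNIV. y $ c * d_pos c (d_vel b ?L) ?p) - d_pos b ?L ?p)"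
  have "spray ?L ?p = (1/4) *\<^sub>R (matrix_inv (finsler_metric ?L ?p) *v E)"
    by (simp add: spray_def E_def matrix_vector_mult_def vec_eq_iff)
  then have "A + (1/2) *\<^sub>R (matrix_inv (finsler_metric ?L ?p) *v E) = 0"
    using geo by simp
  then have "A = - ((1/2) *\<^sub>R (matrix_inv (finsler_metric ?L ?p) *v E))"
    by (simp only: eq_neg_iff_add_eq_0)
  then have "matrix_inv (finsler_metric ?L ?p) *v E = (-2) *\<^sub>R A"
    by simp
  then have gA: "finsler_metric ?L ?p *v ((-2) *\<^sub>R A) = E"
    using matrix_inv_vector_eq_iff[OF finsler_metric_invertible[OF D pos]] by metis
  \<comment> \<open>The velocity Hessian of \<open>L\<close> is twice the metric, so the metric
    applied to \<open>A\<close> supplies the acceleration term missing from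
    \<open>E\<close>.\<close>
  have EL_axis: "dir_deriv (y, A) (d_vel b ?L) ?p = d_pos b ?L ?p" for b
  proof -
    have lin: "linear (\<lambda>v. dir_deriv v (d_vel b ?L) ?p)"
      using linear1[OF D] linear_dir_deriv2(1)[OF open_D smooth D]
      by (simp add: L2 linear_iff algebra_simps)
    have "E $ b = - 2 * (finsler_metric ?L ?p *v A) $ b"
      unfolding gA[symmetric] by (simp only: matrix_vector_mult_scaleR) simp
    then have "dir_deriv (0, axis b 1) (dir_deriv (0, A) ?L) ?p = - E $ b"
      by (simp add: finsler_metric_mult[OF D])
    then have "dir_deriv (0, A) (d_vel b ?L) ?p = - E $ b"
      using commute2[OF D, of "(0, axis b 1)"] by (simp add: L2 mult.commute)
    moreover have "dir_deriv (y, 0) (d_vel b ?L) ?p = (\<Sum>c\<in>UNIV. y $ c * d_pos c (d_vel b ?L) ?p)"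
      by (rule linear_eq_sum_axis[OF linear_compose_Pair(2)[OF lin]])
    ultimately show ?thesis
      using linear_Pair_split[OF lin, of y A] by (simp add: E_def)
  qed
  \<comment> \<open>Half of the Euler-Lagrange expression of \<open>F\<^sup>2\<close>; its first
    summand contains the rate of change of \<open>F\<close> along the geodesic.\<close>
  let ?R = "\<lambda>w. dir_deriv (y, A) F ?p * dir_deriv (0, w) F ?p
    + F ?p * dir_deriv (y, A) (dir_deriv (0, w) F) ?p - F ?p * dir_deriv (w, 0) F ?p"
  have lin: "linear ?R"
    using linear1_Pair[OF D] linear2_Pair(1)[OF D, of "(y, A)"]
    by (simp add: linear_iff algebra_simps)
  have "?R (axis b 1) = 0" for b
    using EL_axis[of b] by (simp add: L1 L2)
  then have R0: "?R w = 0" for w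
    using linear_eq_sum_axis[OF lin, of w] by simp
  \<comment> \<open>The inner direction \<open>(0, y)\<close> is held fixed. Commuting makes it the
    outer one, where Euler's relation applies.\<close>
  have "dir_deriv (y, A) (dir_deriv (0, y) F) ?p = dir_deriv (0, y) (dir_deriv (y, A) F) ?p"
    by (rule commute2[OF D])
  also have "\<dots> = dir_deriv (y, 0) F ?p"
    using linear_Pair_split[OF linear_dir_deriv2(2)[OF open_D smooth D], of "(0, y)" y A] euler[OF D]
    by simp
  finally have "dir_deriv (y, A) F ?p = 0"
    using R0[of y] euler(1)[OF D] nonzero[OF D pos] by simp
  then show ?thesis using R0[of w] nonzero[OF D pos] by simp
qed

text \<open>With \<open>x\<^sup>0\<close> as parameter, the last entry of the direction is the rate
  of change of \<open>\<epsilon>\<close>. Homogeneity moves the spatial equations of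
  \<open>F\<close> to the velocity \<open>(1, \<epsilon>)\<close>.\<close>

lemma geodesic_imp_reduced_equation:
  assumes D: "(x, y) \<in> D" and pos: "y $ 0 > 0"
    and geo: "A + 2 *\<^sub>R spray (finsler_L F) (x, y) = 0"
  defines "\<epsilon> \<equiv> spatial y /\<^sub>R (y $ 0)"
  shows "dir_deriv (1, \<epsilon>, (spatial A - (A $ 0) *\<^sub>R \<epsilon>) /\<^sub>R (y $ 0)\<^sup>2) (d_last \<alpha> (reduced F))
      (x $ 0, spatial x, \<epsilon>) = d_x \<alpha> (reduced F) (x $ 0, spatial x, \<epsilon>)"
proof -
  let ?w = "four 0 (axis \<alpha> 1)"
  define \<sigma> where "\<sigma> = y $ 0"
  have \<sigma>: "\<sigma> > 0" using pos by (simp add: \<sigma>_def)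
  define y1 where "y1 = y /\<^sub>R \<sigma>"
  have y1: "four 1 \<epsilon> = y1" "y = \<sigma> *\<^sub>R y1" and D1: "(x, y1) \<in> D"
    using reduced_point_in_dom[OF D pos] scale(1)[OF D, of "inverse \<sigma>"] pos
    by (simp_all add: \<epsilon>_def y1_def \<sigma>_def)
  \<comment> \<open>Removes the time component of \<open>A\<close>; the change is a multiple of
    \<open>y\<close>, which the velocity Hessian annihilates.\<close>
  define A' where "A' = A - (A $ 0 / \<sigma>) *\<^sub>R y"
  have "A' $ 0 = 0" using pos by (simp add: A'_def \<sigma>_def)
  then have "four 0 (spatial A') = A'" using four_spatial[of A'] by simp
  moreover have "spatial A' = spatial A - (A $ 0) *\<^sub>R \<epsilon>"
    by (simp add: A'_def spatial_diff spatial_scaleR \<epsilon>_def \<sigma>_def divide_inverse)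
  ultimately have A': "four 0 ((spatial A - (A $ 0) *\<^sub>R \<epsilon>) /\<^sub>R \<sigma>\<^sup>2) = A' /\<^sub>R \<sigma>\<^sup>2"
    using scaleR_four[of "inverse (\<sigma>\<^sup>2)" 0 "spatial A'"] by simp
  have lin: "linear (\<lambda>v. dir_deriv v (dir_deriv (0, ?w) F) (x, y))"
    by (rule linear_dir_deriv2(1)[OF open_D smooth D])
  have "dir_deriv (y, A') (dir_deriv (0, ?w) F) (x, y) = dir_deriv (y, A) (dir_deriv (0, ?w) F) (x, y)"
    using euler(3)[OF D] linear_Pair_split[OF lin, of y A] linear_Pair_split[OF lin, of y A']
      linear_diff[OF linear_compose_Pair(1)[OF lin], of A "(A $ 0 / \<sigma>) *\<^sub>R y"]
      linear_scale[OF linear_compose_Pair(1)[OF lin], of "A $ 0 / \<sigma>" y]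
    by (simp add: A'_def)
  also have "\<dots> = dir_deriv (?w, 0) F (x, y)"
    by (rule geodesic_imp_euler_lagrange_F[OF D pos geo])
  also have "\<dots> = \<sigma> * dir_deriv (?w, 0) F (x, y1)"
    using scale_d_pos[OF D1 \<sigma>] y1(2) by simp
  finally have "dir_deriv (y, A') (dir_deriv (0, ?w) F) (x, y) = \<sigma> * dir_deriv (?w, 0) F (x, y1)" .
  moreover have "dir_deriv (y, A') (dir_deriv (0, ?w) F) (x, y)
      = dir_deriv (y, A' /\<^sub>R \<sigma>) (dir_deriv (0, ?w) F) (x, y1)"
    using scale_d_d_vel[OF D1 \<sigma>, of y "A' /\<^sub>R \<sigma>"] y1(2) \<sigma> by simp
  \<comment> \<open>The position direction \<open>y\<close> is still unscaled; extracting
    \<open>\<sigma>\<close> from the whole direction matches the factor on the other side.\<close>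
  moreover have "dir_deriv (y, A' /\<^sub>R \<sigma>) (dir_deriv (0, ?w) F) (x, y1)
      = \<sigma> * dir_deriv (y1, A' /\<^sub>R \<sigma>\<^sup>2) (dir_deriv (0, ?w) F) (x, y1)"
  proof -
    have "(y, A' /\<^sub>R \<sigma>) = \<sigma> *\<^sub>R (y1, A' /\<^sub>R \<sigma>\<^sup>2)"
      using y1(2) \<sigma> by (simp add: power2_eq_square)
    then show ?thesis
      by (simp only: linear_scale[OF linear_dir_deriv2(1)[OF open_D smooth D1]]) simp
  qed
  ultimately have "dir_deriv (y1, A' /\<^sub>R \<sigma>\<^sup>2) (dir_deriv (0, ?w) F) (x, y1)
      = dir_deriv (?w, 0) F (x, y1)"
    using \<sigma> by simp
  then show ?thesis
    using A' by (simp add: \<sigma>_def dir_deriv_reduced four_0_0) (simp add: reduced_def y1(1))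
qed

end

section \<open>Smoothness of the reduced function\<close>

lemma reduced_embedding_has_derivative:
  "((\<lambda>(w, x, \<epsilon>). (four w x, four 1 \<epsilon>)) has_derivative (\<lambda>(w, x, \<epsilon>). (four w x, four 0 \<epsilon>))) (at q)"
proof -
  have lin: "linear (\<lambda>(w, x, \<epsilon>). (four w x, four 0 \<epsilon>))"
    by (rule linearI) (auto simp: four_add scaleR_four)
  have "(\<lambda>(w, x, \<epsilon>). (four w x, four 1 \<epsilon>)) = (\<lambda>q. (\<lambda>(w, x, \<epsilon>). (four w x, four 0 \<epsilon>)) q + (0, four 1 0))"
    by (auto simp: four_add)
  then show ?thesis
    using has_derivative_add_const[OF linear_imp_has_derivative[OF lin]] by simp
qed

lemma reduced_dom_vimage: "reduced_dom D = (\<lambda>(w, x, \<epsilon>). (four w x, four 1 \<epsilon>)) -` D"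
  by (auto simp: reduced_dom_def)

lemma open_reduced_dom:
  assumes "open D"
  shows "open (reduced_dom D)"
  unfolding reduced_dom_vimage
  by (rule open_vimage[OF assms])
    (intro continuous_at_imp_continuous_on ballI
      has_derivative_continuous[OF reduced_embedding_has_derivative])

lemma smooth_on_reduced:
  assumes "open D" "smooth_on F D"
  shows "smooth_on (reduced F) (reduced_dom D)"
  using smooth_on_compose_affine[OF assms(1) reduced_embedding_has_derivative assms(2)]
  by (simp add: reduced_dom_vimage reduced_def case_prod_unfold)

section \<open>The equations of motion of the reduced function\<close>

lemma linear_triple_split:
  fixes g :: "reduced_point \<Rightarrow> real"
  assumes "linear g"
  shows "g (w, x, e) = w * g (1, 0, 0) + g (0, x, 0) + g (0, 0, e)"
proof -
  have "(w, x, e) = (w *\<^sub>R (1, 0, 0) + (0, x, 0)) + (0, 0, e)" by simp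
  then have "g (w, x, e) = g ((w *\<^sub>R (1, 0, 0) + (0, x, 0)) + (0, 0, e))" by simp
  then show ?thesis by (simp only: linear_add[OF assms] linear_scale[OF assms]) simp
qed

lemma linear_triple_compose:
  fixes g :: "reduced_point \<Rightarrow> real"
  assumes "linear g"
  shows "linear (\<lambda>x. g (0, x, 0))" "linear (\<lambda>e. g (0, 0, e))"
  using linear_compose[OF _ assms, of "\<lambda>x. (0, x, 0)"] linear_compose[OF _ assms, of "\<lambda>e. (0, 0, e)"]
  by (auto simp: o_def linear_iff)

text \<open>Multiplying by the Hessian clears the inverse. The remaining terms, up to the factor
  \<open>c\<^sup>2\<close>, are the chain rule for \<open>d_last \<alpha> f\<close> along the stated
  direction.\<close>

lemma spatial_accel_iff:
  fixes a x v :: "real^3" and c t :: real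
  assumes c: "c > 0" and R: "open R" and f: "smooth_on f R"
  defines "q \<equiv> (c * t, x, v /\<^sub>R c)"
  assumes q: "q \<in> R" and inv: "invertible (hess_eps f q)"
  shows "a = spatial_accel c f (t, x, v) \<longleftrightarrow>
    (\<forall>\<alpha>. dir_deriv (1, v /\<^sub>R c, a /\<^sub>R c\<^sup>2) (d_last \<alpha> f) q = d_x \<alpha> f q)"
proof -
  let ?G = "\<lambda>\<beta> u. dir_deriv u (d_last \<beta> f) q"
  have lin: "linear (?G \<beta>)" for \<beta>
    by (rule linear_dir_deriv2(1)[OF R f q])
  define W :: "real^3" where "W = (\<chi> \<beta>. c\<^sup>2 * d_x \<beta> f q
         - c * (deriv (\<lambda>s. d_last \<beta> f (c * s, x, v /\<^sub>R c)) t
                + (\<Sum>\<gamma>\<in>UNIV. v $ \<gamma> * d_x \<gamma> (d_last \<beta> f) q)))"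
  have accel: "spatial_accel c f (t, x, v) = matrix_inv (hess_eps f q) *v W"
    by (simp add: spatial_accel_def Let_def q_def W_def matrix_vector_mult_def vec_eq_iff)
  \<comment> \<open>In \<open>hess_eps\<close> the row index is the outer derivative, in
    \<open>?G\<close> the inner one; symmetry reconciles them.\<close>
  have "(hess_eps f q *v a) $ \<beta> = ?G \<beta> (0, 0, a)" for \<beta>
    using linear_eq_sum_axis[OF linear_triple_compose(2)[OF lin[of \<beta>]], of a]
      dir_deriv_commute[OF R f q, of "(0, 0, axis \<beta> 1)"]
    by (simp add: matrix_vector_mult_def hess_eps_def mult.commute)
  moreover have "W $ \<beta> = c\<^sup>2 * d_x \<beta> f q - c\<^sup>2 * ?G \<beta> (1, 0, 0) - c * ?G \<beta> (0, v, 0)" for \<beta>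
  proof -
    \<comment> \<open>The derivative in \<open>t\<close> is \<open>c\<close> times that in
      \<open>x\<^sup>0\<close>, which with the prefactor \<open>c\<close> gives
      \<open>c\<^sup>2\<close>.\<close>
    have "((\<lambda>s. (c * s, x, v /\<^sub>R c)) has_vector_derivative (c, 0, 0)) (at t)"
      by (auto intro!: derivative_eq_intros simp: zero_prod_def)
    then have "((\<lambda>s. d_last \<beta> f (c * s, x, v /\<^sub>R c)) has_real_derivative ?G \<beta> (c, 0, 0)) (at t)"
      unfolding q_def
      by (rule smooth_on_has_derivative_curve[OF smooth_on_dir_deriv[OF R f], rotated])
        (use q in \<open>simp add: q_def\<close>)
    then have "deriv (\<lambda>s. d_last \<beta> f (c * s, x, v /\<^sub>R c)) t = c * ?G \<beta> (1, 0, 0)"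
      using DERIV_imp_deriv linear_scale[OF lin[of \<beta>], of c "(1, 0, 0)"] by fastforce
    moreover have "(\<Sum>\<gamma>\<in>UNIV. v $ \<gamma> * d_x \<gamma> (d_last \<beta> f) q) = ?G \<beta> (0, v, 0)"
      using linear_eq_sum_axis[OF linear_triple_compose(1)[OF lin[of \<beta>]], of v] by simp
    ultimately show ?thesis by (simp add: W_def algebra_simps power2_eq_square)
  qed
  moreover have "c\<^sup>2 * ?G \<beta> (1, v /\<^sub>R c, a /\<^sub>R c\<^sup>2)
      = c\<^sup>2 * ?G \<beta> (1, 0, 0) + c * ?G \<beta> (0, v, 0) + ?G \<beta> (0, 0, a)" for \<beta>
    using linear_triple_split[OF lin[of \<beta>], of 1 "v /\<^sub>R c" "a /\<^sub>R c\<^sup>2"]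
      linear_scale[OF linear_triple_compose(1)[OF lin[of \<beta>]], of "inverse c" v]
      linear_scale[OF linear_triple_compose(2)[OF lin[of \<beta>]], of "inverse (c\<^sup>2)" a] c
    by (simp add: field_simps power2_eq_square)
  ultimately have "(hess_eps f q *v a) $ \<beta> = W $ \<beta> \<longleftrightarrow>
      c\<^sup>2 * ?G \<beta> (1, v /\<^sub>R c, a /\<^sub>R c\<^sup>2) = c\<^sup>2 * d_x \<beta> f q" for \<beta>
    by auto
  then have "hess_eps f q *v a = W \<longleftrightarrow> (\<forall>\<beta>. ?G \<beta> (1, v /\<^sub>R c, a /\<^sub>R c\<^sup>2) = d_x \<beta> f q)"
    using c by (simp add: vec_eq_iff)
  then show ?thesis
    unfolding accel matrix_inv_vector_eq_iff[OF inv] .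
qed

lemma dir_deriv_as_lagrangian:
  "dir_deriv (w, x', v') (as_lagrangian c f) (t, x, v)
    = dir_deriv (c * w, x', v' /\<^sub>R c) f (c * t, x, v /\<^sub>R c)"
  by (simp add: dir_deriv_def as_lagrangian_def algebra_simps)

lemma velocity_has_vector_derivative:
  assumes "twice_differentiable_on X I" "\<tau> \<in> I"
  shows "(X has_vector_derivative velocity X \<tau>) (at \<tau>)"
    and "(velocity X has_vector_derivative velocity (velocity X) \<tau>) (at \<tau>)"
  using assms unfolding twice_differentiable_on_def velocity_def[of X \<tau>]
    velocity_def[of "velocity X" \<tau>]
  by (simp_all add: vector_derivative_works)

text \<open>The momentum is \<open>d_last \<alpha> f / c\<close>, and \<open>?\<Gamma>\<close> moves
  with \<open>c\<close> times the stated direction, so the factors cancel.\<close>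

lemma euler_lagrange_at_iff:
  assumes c: "c > 0" and R: "open R" and f: "smooth_on f R"
    and J: "open J" and \<xi>: "twice_differentiable_on \<xi> J"
    and dom: "\<And>s. s \<in> J \<Longrightarrow> (c * s, \<xi> s, velocity \<xi> s /\<^sub>R c) \<in> R"
    and t: "t \<in> J"
  shows "euler_lagrange_at (as_lagrangian c f) \<xi> t \<longleftrightarrow>
    (\<forall>\<alpha>. dir_deriv (1, velocity \<xi> t /\<^sub>R c, velocity (velocity \<xi>) t /\<^sub>R c\<^sup>2) (d_last \<alpha> f)
        (c * t, \<xi> t, velocity \<xi> t /\<^sub>R c) = d_x \<alpha> f (c * t, \<xi> t, velocity \<xi> t /\<^sub>R c))"
proof -
  let ?\<Gamma> = "\<lambda>s. (c * s, \<xi> s, velocity \<xi> s /\<^sub>R c)"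
  let ?v = "velocity \<xi> t" and ?a = "velocity (velocity \<xi>) t"
  have deriv: "((\<lambda>s. d_last \<alpha> (as_lagrangian c f) (s, \<xi> s, velocity \<xi> s)) has_real_derivative
      dir_deriv (1, ?v /\<^sub>R c, ?a /\<^sub>R c\<^sup>2) (d_last \<alpha> f) (?\<Gamma> t)) (at t)" for \<alpha>
  proof -
    have "(?\<Gamma> has_vector_derivative (c, ?v, ?a /\<^sub>R c)) (at t)"
      using velocity_has_vector_derivative[OF \<xi> t]
      by (auto intro!: derivative_eq_intros)
    then have "((\<lambda>s. d_last \<alpha> f (?\<Gamma> s)) has_real_derivative
        dir_deriv (c, ?v, ?a /\<^sub>R c) (d_last \<alpha> f) (?\<Gamma> t)) (at t)"
      by (rule smooth_on_has_derivative_curve[OF smooth_on_dir_deriv[OF R f], rotated])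
        (use dom t in simp)
    then have "((\<lambda>s. d_last \<alpha> f (?\<Gamma> s) / c) has_real_derivative
        dir_deriv (c, ?v, ?a /\<^sub>R c) (d_last \<alpha> f) (?\<Gamma> t) / c) (at t)"
      by (rule DERIV_cdivide)
    moreover have "dir_deriv (c, ?v, ?a /\<^sub>R c) (d_last \<alpha> f) (?\<Gamma> t)
        = c * dir_deriv (1, ?v /\<^sub>R c, ?a /\<^sub>R c\<^sup>2) (d_last \<alpha> f) (?\<Gamma> t)"
    proof -
      have "(c, ?v, ?a /\<^sub>R c) = c *\<^sub>R (1, ?v /\<^sub>R c, ?a /\<^sub>R c\<^sup>2)"
        using c by (simp add: power2_eq_square)
      then show ?thesis
        by (simp only: linear_scale[OF linear_dir_deriv2(1)[OF R f dom[OF t]]]) simp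
    qed
    ultimately have "((\<lambda>s. d_last \<alpha> f (?\<Gamma> s) / c) has_real_derivative
        dir_deriv (1, ?v /\<^sub>R c, ?a /\<^sub>R c\<^sup>2) (d_last \<alpha> f) (?\<Gamma> t)) (at t)"
      using c by simp
    then show ?thesis
    proof (rule has_field_derivative_transform_within_open[OF _ J t])
      fix s assume "s \<in> J"
      show "d_last \<alpha> f (?\<Gamma> s) / c = d_last \<alpha> (as_lagrangian c f) (s, \<xi> s, velocity \<xi> s)"
        using linear_scale[OF linear_dir_deriv[OF f dom[OF \<open>s \<in> J\<close>]], of "inverse c" "(0, 0, axis \<alpha> 1)"]
        by (simp add: dir_deriv_as_lagrangian divide_inverse mult.commute)
    qed
  qed
  have "d_x \<alpha> (as_lagrangian c f) (t, \<xi> t, ?v) = d_x \<alpha> f (?\<Gamma> t)" for \<alpha>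
    by (simp add: dir_deriv_as_lagrangian)
  then show ?thesis
    \<comment> \<open>Uniqueness of the derivative fixes the existential \<open>m\<close>, which
      gives both implications.\<close>
    unfolding euler_lagrange_at_def using deriv DERIV_unique by fastforce
qed

section \<open>Reparametrization by coordinate time\<close>

lemma bounded_linear_spatial: "bounded_linear spatial"
  by (rule linear_conv_bounded_linear[THEN iffD1], rule linearI) (simp_all add: spatial_add spatial_scaleR)

text \<open>A positive derivative on an interval gives strict monotonicity; invariance of domain
  makes the image open, and the inverse function rule applies.\<close>

lemma coord_time_inverse:
  assumes c: "c > 0" and I: "open I" "is_interval I" and X: "twice_differentiable_on X I"
    and pos: "\<forall>\<tau>\<in>I. deriv (coord_time c X) \<tau> > 0"
  shows "inj_on (coord_time c X) I" "open (coord_time c X ` I)"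
    and "\<And>\<tau>. \<tau> \<in> I \<Longrightarrow> velocity X \<tau> $ 0 > 0"
    and "\<And>\<tau>. \<tau> \<in> I \<Longrightarrow> (the_inv_into I (coord_time c X) has_real_derivative c / velocity X \<tau> $ 0)
           (at (coord_time c X \<tau>))"
proof -
  let ?T = "coord_time c X"
  have dT: "(?T has_real_derivative velocity X \<tau> $ 0 / c) (at \<tau>)" if "\<tau> \<in> I" for \<tau>
    unfolding coord_time_def
    using bounded_linear.has_vector_derivative[OF bounded_linear_vec_nth
        velocity_has_vector_derivative(1)[OF X that], of 0]
    by (intro DERIV_cdivide) (simp add: has_real_derivative_iff_has_vector_derivative)
  show vel: "velocity X \<tau> $ 0 > 0" if "\<tau> \<in> I" for \<tau>
    using bspec[OF pos that] DERIV_imp_deriv[OF dT[OF that]] c by (simp add: zero_less_divide_iff)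
  have mono: "?T \<sigma> < ?T \<tau>" if "\<sigma> \<in> I" "\<tau> \<in> I" "\<sigma> < \<tau>" for \<sigma> \<tau>
  proof (rule DERIV_pos_imp_increasing[OF that(3)])
    fix s assume "\<sigma> \<le> s" "s \<le> \<tau>"
    then have "s \<in> I" using I(2) that unfolding is_interval_1 by blast
    then show "\<exists>y. (?T has_real_derivative y) (at s) \<and> 0 < y"
      using dT vel c by (meson divide_pos_pos)
  qed
  show inj: "inj_on ?T I"
    by (rule linorder_inj_onI') (use mono in fastforce)
  have cont: "continuous_on I ?T"
    using dT by (intro continuous_at_imp_continuous_on ballI) (rule DERIV_isCont)
  show "open (?T ` I)"
    by (rule invariance_of_domain[OF cont I(1) inj])
  show "(the_inv_into I ?T has_real_derivative c / velocity X \<tau> $ 0) (at (?T \<tau>))"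
    if "\<tau> \<in> I" for \<tau>
    unfolding has_field_derivative_def
  proof (rule has_derivative_inverse_strong[OF I(1) that cont])
    show "the_inv_into I ?T (?T \<sigma>) = \<sigma>" if "\<sigma> \<in> I" for \<sigma>
      using the_inv_into_f_f[OF inj that] .
    show "(?T has_derivative (*) (velocity X \<tau> $ 0 / c)) (at \<tau>)"
      using dT[OF that] by (simp add: has_field_derivative_def)
    show "(*) (velocity X \<tau> $ 0 / c) \<circ> (*) (c / velocity X \<tau> $ 0) = id"
      using vel[OF that] c by (simp add: fun_eq_iff)
  qed
qed

text \<open>The chain rule with \<open>dt = (velocity X \<tau> $ 0 / c) d\<tau>\<close>, used twice;
  the quotient rule for \<open>\<epsilon>\<close> produces the subtracted term.\<close>

lemma by_coord_time_derivatives: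
  assumes c: "c > 0" and I: "open I" "is_interval I" and X: "twice_differentiable_on X I"
    and pos: "\<forall>\<tau>\<in>I. deriv (coord_time c X) \<tau> > 0"
  defines "\<xi> \<equiv> by_coord_time c I X" and "\<epsilon> \<equiv> \<lambda>\<tau>. spatial (velocity X \<tau>) /\<^sub>R (velocity X \<tau> $ 0)"
  shows "twice_differentiable_on \<xi> (coord_time c X ` I)"
    and "\<And>\<tau>. \<tau> \<in> I \<Longrightarrow> \<xi> (coord_time c X \<tau>) = spatial (X \<tau>)"
    and "\<And>\<tau>. \<tau> \<in> I \<Longrightarrow> velocity \<xi> (coord_time c X \<tau>) = c *\<^sub>R \<epsilon> \<tau>"
    and "\<And>\<tau>. \<tau> \<in> I \<Longrightarrow> velocity (velocity \<xi>) (coord_time c X \<tau>)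
      = c\<^sup>2 *\<^sub>R ((spatial (velocity (velocity X) \<tau>) - (velocity (velocity X) \<tau> $ 0) *\<^sub>R \<epsilon> \<tau>)
          /\<^sub>R (velocity X \<tau> $ 0)\<^sup>2)"
proof -
  let ?T = "coord_time c X" and ?g = "the_inv_into I (coord_time c X)"
  note T = coord_time_inverse[OF c I X pos]
  have g: "?g (?T \<tau>) = \<tau>" if "\<tau> \<in> I" for \<tau>
    using the_inv_into_f_f[OF T(1) that] .
  show \<xi>: "\<xi> (?T \<tau>) = spatial (X \<tau>)" if "\<tau> \<in> I" for \<tau>
    using g[OF that] by (simp add: \<xi>_def by_coord_time_def)
  have chain: "((\<lambda>t. h (?g t)) has_vector_derivative (c / velocity X \<tau> $ 0) *\<^sub>R h') (at (?T \<tau>))"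
    if "\<tau> \<in> I" "(h has_vector_derivative h') (at \<tau>)" for \<tau> h' and h :: "real \<Rightarrow> real^3"
    using vector_diff_chain_at[of ?g _ "?T \<tau>" h h'] T(4)[OF that(1)] that g[OF that(1)]
    by (simp add: has_real_derivative_iff_has_vector_derivative o_def)
  have d\<xi>: "(\<xi> has_vector_derivative c *\<^sub>R \<epsilon> \<tau>) (at (?T \<tau>))" if "\<tau> \<in> I" for \<tau>
    using chain[OF that bounded_linear.has_vector_derivative[OF bounded_linear_spatial
          velocity_has_vector_derivative(1)[OF X that]]]
    by (simp add: \<xi>_def by_coord_time_def[abs_def] \<epsilon>_def divide_inverse)
  then show v: "velocity \<xi> (?T \<tau>) = c *\<^sub>R \<epsilon> \<tau>" if "\<tau> \<in> I" for \<tau>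
    using that by (simp add: velocity_def vector_derivative_at)
  have d\<epsilon>: "((\<lambda>\<tau>. c *\<^sub>R \<epsilon> \<tau>) has_vector_derivative (c / velocity X \<tau> $ 0) *\<^sub>R
      (spatial (velocity (velocity X) \<tau>) - (velocity (velocity X) \<tau> $ 0) *\<^sub>R \<epsilon> \<tau>)) (at \<tau>)"
    if "\<tau> \<in> I" for \<tau>
  proof -
    let ?y = "velocity X \<tau>" and ?A = "velocity (velocity X) \<tau>"
    note d = velocity_has_vector_derivative(2)[OF X that]
    have "((\<lambda>s. velocity X s $ 0) has_real_derivative ?A $ 0) (at \<tau>)"
      using bounded_linear.has_vector_derivative[OF bounded_linear_vec_nth d, of 0]
      by (simp add: has_real_derivative_iff_has_vector_derivative)
    then have "((\<lambda>s. inverse (velocity X s $ 0)) has_real_derivative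
        - (inverse (?y $ 0) * (?A $ 0) * inverse (?y $ 0))) (at \<tau>)"
      using T(3)[OF that] by (intro DERIV_inverse') auto
    from has_vector_derivative_scaleR[OF this
        bounded_linear.has_vector_derivative[OF bounded_linear_spatial d]]
    have "(\<epsilon> has_vector_derivative inverse (?y $ 0) *\<^sub>R spatial ?A
        + (- (inverse (?y $ 0) * (?A $ 0) * inverse (?y $ 0))) *\<^sub>R spatial ?y) (at \<tau>)"
      by (simp add: \<epsilon>_def)
    moreover have "inverse (?y $ 0) *\<^sub>R spatial ?A
        + (- (inverse (?y $ 0) * (?A $ 0) * inverse (?y $ 0))) *\<^sub>R spatial ?y
      = inverse (?y $ 0) *\<^sub>R (spatial ?A - (?A $ 0) *\<^sub>R \<epsilon> \<tau>)"
      by (simp add: \<epsilon>_def scaleR_diff_right mult.assoc)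
    ultimately have "(\<epsilon> has_vector_derivative
        inverse (?y $ 0) *\<^sub>R (spatial ?A - (?A $ 0) *\<^sub>R \<epsilon> \<tau>)) (at \<tau>)"
      by simp
    from bounded_linear.has_vector_derivative[OF bounded_linear_scaleR_right this, of c]
    show ?thesis by (simp add: divide_inverse)
  qed
  have d2\<xi>: "(velocity \<xi> has_vector_derivative c\<^sup>2 *\<^sub>R
      ((spatial (velocity (velocity X) \<tau>) - (velocity (velocity X) \<tau> $ 0) *\<^sub>R \<epsilon> \<tau>)
          /\<^sub>R (velocity X \<tau> $ 0)\<^sup>2)) (at (?T \<tau>))"
    if "\<tau> \<in> I" for \<tau>
  \<comment> \<open>The formula for \<open>velocity \<xi>\<close> is known only on the image of
    \<open>I\<close>, whose openness makes it differentiable there.\<close>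
  proof (rule has_vector_derivative_transform_within_open[OF _ T(2) imageI[OF that]])
    show "((\<lambda>t. c *\<^sub>R \<epsilon> (?g t)) has_vector_derivative c\<^sup>2 *\<^sub>R
      ((spatial (velocity (velocity X) \<tau>) - (velocity (velocity X) \<tau> $ 0) *\<^sub>R \<epsilon> \<tau>)
          /\<^sub>R (velocity X \<tau> $ 0)\<^sup>2)) (at (?T \<tau>))"
      using chain[OF that d\<epsilon>[OF that]]
      by (simp add: power2_eq_square divide_inverse mult_ac)
    show "c *\<^sub>R \<epsilon> (?g t) = velocity \<xi> t" if "t \<in> ?T ` I" for t
      using that v g by auto
  qed
  then show "velocity (velocity \<xi>) (?T \<tau>)
      = c\<^sup>2 *\<^sub>R ((spatial (velocity (velocity X) \<tau>) - (velocity (velocity X) \<tau> $ 0) *\<^sub>R \<epsilon> \<tau>)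
          /\<^sub>R (velocity X \<tau> $ 0)\<^sup>2)" if "\<tau> \<in> I" for \<tau>
    using that unfolding velocity_def[of "velocity \<xi>"] by (simp add: vector_derivative_at)
  show "twice_differentiable_on \<xi> (?T ` I)"
    unfolding twice_differentiable_on_def
    using d\<xi> d2\<xi> differentiableI_vector by blast
qed

text \<open>The second conjunct expresses that the equations of motion are the same: it concerns all
  curves with reduced point in the domain, geodesic or not.\<close>

theorem mainTheorem2:
  fixes D :: "tangent_point set"
    and F :: "tangent_point \<Rightarrow> real"
    and f :: "reduced_point \<Rightarrow> real"
    and c :: real
  assumes "c > 0"
    and "open D"
    and "smooth_on F D"
    and "pos_homogeneous_on D F"
    and "f = reduced F"
    and "\<And>p. p \<in> reduced_dom D \<Longrightarrow> f p \<noteq> 0"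
    and "\<And>p. p \<in> reduced_dom D \<Longrightarrow> invertible (hess_eps f p)"
  shows
    "(\<forall>I X. finsler_geodesic D (finsler_L F) I X \<longrightarrow>
        (\<forall>\<tau>\<in>I. deriv (coord_time c X) \<tau> > 0) \<longrightarrow>
        (let J = coord_time c X ` I; \<xi> = by_coord_time c I X in
           inj_on (coord_time c X) I \<and> open J \<and> twice_differentiable_on \<xi> J \<and>
           (\<forall>t\<in>J. velocity (velocity \<xi>) t = spatial_accel c f (t, \<xi> t, velocity \<xi> t) \<and>
                  euler_lagrange_at (as_lagrangian c f) \<xi> t)))
     \<and> (\<forall>J \<xi>. open J \<longrightarrow> twice_differentiable_on \<xi> J \<longrightarrow>
        (\<forall>t\<in>J. (c * t, \<xi> t, velocity \<xi> t /\<^sub>R c) \<in> reduced_dom D) \<longrightarrow>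
        (\<forall>t\<in>J. velocity (velocity \<xi>) t = spatial_accel c f (t, \<xi> t, velocity \<xi> t) \<longleftrightarrow>
               euler_lagrange_at (as_lagrangian c f) \<xi> t))"
proof -
  interpret conic_finsler D F
    by unfold_locales (use assms in auto)
  let ?R = "reduced_dom D"
  have R: "open ?R" and f: "smooth_on f ?R"
    using open_reduced_dom[OF assms(2)] smooth_on_reduced[OF assms(2,3)] assms(5) by auto
  \<comment> \<open>Both equations of motion are equivalent to one and the same chain-rule equation
    for \<open>f\<close>.\<close>
  note accel_iff = spatial_accel_iff[OF assms(1) R f _ assms(7)]
    and EL_iff = euler_lagrange_at_iff[OF assms(1) R f]
  have part2: "velocity (velocity \<xi>) t = spatial_accel c f (t, \<xi> t, velocity \<xi> t) \<longleftrightarrow>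
      euler_lagrange_at (as_lagrangian c f) \<xi> t"
    if "open J" "twice_differentiable_on \<xi> J" "t \<in> J"
      "\<forall>t\<in>J. (c * t, \<xi> t, velocity \<xi> t /\<^sub>R c) \<in> ?R" for J \<xi> t
    using EL_iff[OF that(1,2) _ that(3)] accel_iff that(3,4) by simp
  have part1: "inj_on (coord_time c X) I \<and> open J \<and> twice_differentiable_on \<xi> J \<and>
      (\<forall>t\<in>J. velocity (velocity \<xi>) t = spatial_accel c f (t, \<xi> t, velocity \<xi> t) \<and>
             euler_lagrange_at (as_lagrangian c f) \<xi> t)"
    if geo: "finsler_geodesic D (finsler_L F) I X"
      and pos: "\<forall>\<tau>\<in>I. deriv (coord_time c X) \<tau> > 0"
      and J: "J = coord_time c X ` I" and \<xi>: "\<xi> = by_coord_time c I X" for I X J \<xi>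
  proof -
    have I: "open I" "is_interval I" and X: "twice_differentiable_on X I"
      and XD: "\<And>\<tau>. \<tau> \<in> I \<Longrightarrow> (X \<tau>, velocity X \<tau>) \<in> D"
      and spray: "\<And>\<tau>. \<tau> \<in> I \<Longrightarrow>
        velocity (velocity X) \<tau> + 2 *\<^sub>R spray (finsler_L F) (X \<tau>, velocity X \<tau>) = 0"
      using geo by (auto simp: finsler_geodesic_def)
    note T = coord_time_inverse[OF assms(1) I X pos]
    note d\<xi> = by_coord_time_derivatives[OF assms(1) I X pos, folded \<xi>]
    have point: "(c * coord_time c X \<tau>, \<xi> (coord_time c X \<tau>), velocity \<xi> (coord_time c X \<tau>) /\<^sub>R c)
        = (X \<tau> $ 0, spatial (X \<tau>), spatial (velocity X \<tau>) /\<^sub>R (velocity X \<tau> $ 0))"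
      if "\<tau> \<in> I" for \<tau>
      using d\<xi>(2,3)[OF that] assms(1) by (simp add: coord_time_def)
    have dom: "\<forall>t\<in>J. (c * t, \<xi> t, velocity \<xi> t /\<^sub>R c) \<in> ?R"
      using point reduced_point_in_dom(1)[OF XD T(3)] by (auto simp: J)
    have "velocity (velocity \<xi>) t = spatial_accel c f (t, \<xi> t, velocity \<xi> t)" if "t \<in> J" for t
    proof -
      obtain \<tau> where \<tau>: "\<tau> \<in> I" "t = coord_time c X \<tau>" using \<open>t \<in> J\<close> J by blast
      \<comment> \<open>The factor \<open>c\<^sup>2\<close> of the acceleration in
        \<open>d\<xi>(4)\<close> cancels, leaving the direction of
        \<open>geodesic_imp_reduced_equation\<close>.\<close>
      have "dir_deriv (1, velocity \<xi> t /\<^sub>R c, velocity (velocity \<xi>) t /\<^sub>R c\<^sup>2) (d_last \<alpha> f)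
          (c * t, \<xi> t, velocity \<xi> t /\<^sub>R c) = d_x \<alpha> f (c * t, \<xi> t, velocity \<xi> t /\<^sub>R c)" for \<alpha>
        using geodesic_imp_reduced_equation[OF XD[OF \<tau>(1)] T(3)[OF \<tau>(1)] spray[OF \<tau>(1)], of \<alpha>]
          point[OF \<tau>(1)] d\<xi>(4)[OF \<tau>(1)] assms(1)
        by (simp add: \<tau>(2) assms(5) mult.assoc[symmetric])
      then show ?thesis using accel_iff dom that by blast
    qed
    then show ?thesis
      using part2[OF _ _ _ dom] T(1,2) d\<xi>(1) J by blast
  qed
  show ?thesis
    unfolding Let_def using part1[OF _ _ refl refl] part2 by blast
qed

end
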